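(* Let $\ell_n:\mathbb{R}^p\to\mathbb{R}$ be a (random, data-dependent) convex loss, let $\beta^\star\in\mathbb{R}^p$ be the true parameter with support $\mathcal{A}=\{j:\beta^\star_j\neq 0\}$, let $\lambda>0$, let $P_\lambda$ be a folded concave penalty with constants $a_1,a_2,a$, and let $a_0=\min\{1,a_2\}$. Consider the problem $\min_\beta \ell_n(\beta)+\sum_jP_\lambda(|\beta_j|)$, and suppose $\|\beta^\star_{\mathcal{A}}\|_{\min}>(a+1)\lambda$. Then the LLA algorithm initialized by the (random) estimator $\hat\beta^{\mathrm{initial}}$ converges to $\hat\beta^{\mathrm{oracle}}$ after two iterations with probability at least $1-\delta_0-\delta_1-\delta_2$, where $$\delta_0=\Pr\left(\|\hat\beta^{\mathrm{initial}}-\beta^\star\|_{\max}>a_0\lambda\right),\quad \delta_1=\Pr\left(\|\nabla_{\mathcal{A}^c}\ell_n(\hat\beta^{\mathrm{oracle}})\|_{\max}\ge a_1\lambda\right),\quad \delta_2=\Pr\left(\|\hat\beta^{\mathrm{oracle}}_{\mathcal{A}}\|_{\min}\le a\lambda\right).$$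
   Context: Notation: $\|v\|_{\max}=\max_j|v_j|$, $\|v\|_{\min}=\min_j|v_j|$; $v_{\mathcal{A}}$ is the subvector indexed by $\mathcal{A}$. Folded concave penalty: $P_\lambda(|t|)$, $t\in\mathbb{R}$, where, for fixed constants $a_1,a_2>0$ and $a>a_2$: (i) $P_\lambda(t)$ is increasing and concave on $[0,\infty)$ with $P_\lambda(0)=0$; (ii) $P_\lambda$ is differentiable on $(0,\infty)$ with $P'_\lambda(0):=P'_\lambda(0+)\ge a_1\lambda$; (iii) $P'_\lambda(t)\ge a_1\lambda$ for $t\in(0,a_2\lambda]$; (iv) $P'_\lambda(t)=0$ for $t\in[a\lambda,\infty)$. Oracle estimator: $\hat\beta^{\mathrm{oracle}}=(\hat\beta^{\mathrm{oracle}}_{\mathcal{A}},0)=\arg\min_{\beta:\beta_{\mathcal{A}^c}=0}\ell_n(\beta)$. Standing assumption: this minimizer exists and is unique, and $\nabla_j\ell_n(\hat\beta^{\mathrm{oracle}})=0$ for all $j\in\mathcal{A}$. Here $\nabla\ell_n(\hat\beta^{\mathrm{oracle}})$ denotes a (fixed) subgradient vector of $\ell_n$ at $\hat\beta^{\mathrm{oracle}}$ with this property (the gradient if $\ell_n$ is differentiable), and $\nabla_{\mathcal{A}^c}\ell_n(\hat\beta^{\mathrm{oracle}})$ is its subvector indexed by $\mathcal{A}^c$. LLA (local linear approximation) algorithm: set $\hat\beta^{(0)}=\hat\beta^{\mathrm{initial}}$; for $m=1,2,\ldots$ let $\hat w^{(m-1)}_j=P'_\lambda(|\hat\beta^{(m-1)}_j|)$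 and $\hat\beta^{(m)}=\arg\min_\beta\ \ell_n(\beta)+\sum_j\hat w^{(m-1)}_j|\beta_j|$. "Converges to $\hat\beta^{\mathrm{oracle}}$ after two iterations" means that the first iteration finds the oracle estimator and the second reproduces it: $\hat\beta^{(1)}=\hat\beta^{(2)}=\hat\beta^{\mathrm{oracle}}$ (so the algorithm has reached a fixed point). *)

theory Defs
  imports "HOL-Probability.Probability"
begin

text \<open>
  Max and min norm of the subvector \<open>v\<^sub>S\<close>. They are \<open>ereal\<close>-valued because \<open>S\<close> may be
  empty: the max is then \<open>-\<infinity>\<close> and the min is \<open>\<infinity>\<close>. For nonempty \<open>S\<close> they are the real
  maximum and minimum.
\<close>

definition max_norm_on :: "'p::finite set \<Rightarrow> real ^ 'p \<Rightarrow> ereal" where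
  "max_norm_on S v = (SUP j\<in>S. ereal \<bar>v $ j\<bar>)"

definition min_norm_on :: "'p::finite set \<Rightarrow> real ^ 'p \<Rightarrow> ereal" where
  "min_norm_on S v = (INF j\<in>S. ereal \<bar>v $ j\<bar>)"

definition is_unique_arg_min :: "('a \<Rightarrow> 'b::ord) \<Rightarrow> ('a \<Rightarrow> bool) \<Rightarrow> 'a \<Rightarrow> bool" where
  "is_unique_arg_min f Q x \<longleftrightarrow> is_arg_min f Q x \<and> (\<forall>y. is_arg_min f Q y \<longrightarrow> y = x)"

definition is_subgradient :: "('a::real_inner \<Rightarrow> real) \<Rightarrow> 'a \<Rightarrow> 'a \<Rightarrow> bool" where
  "is_subgradient f x g \<longleftrightarrow> (\<forall>y. f y \<ge> f x + g \<bullet> (y - x))"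

text \<open>The derivative of a penalty on \<open>[0, \<infinity>)\<close>, with the convention \<open>P'(0) := P'(0+)\<close>.\<close>

definition penalty_deriv :: "(real \<Rightarrow> real) \<Rightarrow> real \<Rightarrow> real" where
  "penalty_deriv P t = (if t = 0 then Lim (at_right 0) (deriv P) else deriv P t)"

text \<open>
  \<open>P\<close> is the penalty at the fixed level \<open>lam\<close>; only its values on \<open>[0, \<infinity>)\<close> matter.
  ``Increasing'' is not strict, since the derivative vanishes beyond \<open>a * lam\<close>. The limit
  \<open>P'(0+)\<close> is required to exist as a real number, so that \<^const>\<open>Lim\<close> above is meaningful.
\<close>

definition folded_concave_penalty ::
  "real \<Rightarrow> real \<Rightarrow> real \<Rightarrow> real \<Rightarrow> (real \<Rightarrow> real) \<Rightarrow> bool" where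
  "folded_concave_penalty a1 a2 a lam P \<longleftrightarrow>
     0 < a1 \<and> 0 < a2 \<and> a2 < a \<and>
     mono_on {0..} P \<and> concave_on {0..} P \<and> P 0 = 0 \<and>
     (\<forall>t>0. P differentiable (at t)) \<and>
     (\<exists>L. (deriv P \<longlongrightarrow> L) (at_right 0)) \<and> penalty_deriv P 0 \<ge> a1 * lam \<and>
     (\<forall>t. 0 < t \<and> t \<le> a2 * lam \<longrightarrow> penalty_deriv P t \<ge> a1 * lam) \<and>
     (\<forall>t\<ge>a * lam. penalty_deriv P t = 0)"

definition is_oracle_estimator ::
  "(real ^ 'p::finite \<Rightarrow> real) \<Rightarrow> 'p set \<Rightarrow> real ^ 'p \<Rightarrow> bool" where
  "is_oracle_estimator loss A b \<longleftrightarrow> is_unique_arg_min loss (\<lambda>\<beta>. \<forall>j\<in>-A. \<beta> $ j = 0) b"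

definition lla_objective ::
  "(real ^ 'p::finite \<Rightarrow> real) \<Rightarrow> (real \<Rightarrow> real) \<Rightarrow> real ^ 'p \<Rightarrow> real ^ 'p \<Rightarrow> real" where
  "lla_objective loss P b \<beta> = loss \<beta> + (\<Sum>j\<in>UNIV. penalty_deriv P \<bar>b $ j\<bar> * \<bar>\<beta> $ j\<bar>)"

text \<open>
  ``\<open>b\<^sub>m = arg min\<close>'' is read as: the minimizer exists, is unique, and is \<open>b\<^sub>m\<close>. Hence there is
  at most one sequence of iterates for a given starting point, and the existential quantifier
  in \<open>lla_converges_after_two\<close> says that this sequence exists and has the stated property.
\<close>

definition lla_iterates ::
  "(real ^ 'p::finite \<Rightarrow> real) \<Rightarrow> (real \<Rightarrow> real) \<Rightarrow> real ^ 'p \<Rightarrow> (nat \<Rightarrow> real ^ 'p) \<Rightarrow> bool" where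
  "lla_iterates loss P init b \<longleftrightarrow>
     b 0 = init \<and>
     (\<forall>m. is_unique_arg_min (lla_objective loss P (b m)) (\<lambda>_. True) (b (Suc m)))"

definition lla_converges_after_two ::
  "(real ^ 'p::finite \<Rightarrow> real) \<Rightarrow> (real \<Rightarrow> real) \<Rightarrow> real ^ 'p \<Rightarrow> real ^ 'p \<Rightarrow> bool" where
  "lla_converges_after_two loss P init orac \<longleftrightarrow>
     (\<exists>b. lla_iterates loss P init b \<and> b 1 = orac \<and> b 2 = orac)"

end

theory Submission
  imports Defs
begin

text \<open>
  On the complement of the three exceptional events, both the initial estimator and the oracle
  estimator induce LLA weights that vanish on \<open>A\<close> and are at least \<open>a1 * lam\<close> off \<open>A\<close>. As the
  subgradient vanishes on \<open>A\<close> and is smaller than \<open>a1 * lam\<close> off \<open>A\<close>, the subgradient inequality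
  makes the oracle estimator the unique minimizer of either weighted problem, and a union bound
  concludes.

  A non-measurable event would have \<^const>\<open>measure\<close> zero, so the event of convergence has to be
  shown measurable. For a convex function, being the unique minimizer is equivalent to a
  condition that only quantifies over countable sets.
\<close>

section \<open>Countable criterion for unique minimizers of convex functions\<close>

lemma is_unique_arg_min_UNIV_iff:
  fixes f :: "'a \<Rightarrow> 'b::linorder"
  shows "is_unique_arg_min f (\<lambda>_. True) x \<longleftrightarrow> (\<forall>y. y \<noteq> x \<longrightarrow> f x < f y)"
proof
  assume x: "is_unique_arg_min f (\<lambda>_. True) x"
  show "\<forall>y. y \<noteq> x \<longrightarrow> f x < f y"
  proof (intro allI impI, rule ccontr)
    fix y assume "y \<noteq> x" and le: "\<not> f x < f y"
    have "is_arg_min f (\<lambda>_. True) y"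
      using x le is_arg_min_antimono[of f "\<lambda>_. True" x y]
      unfolding is_unique_arg_min_def by (simp only: not_less)
    with x \<open>y \<noteq> x\<close> show False unfolding is_unique_arg_min_def by blast
  qed
next
  assume "\<forall>y. y \<noteq> x \<longrightarrow> f x < f y"
  then show "is_unique_arg_min f (\<lambda>_. True) x"
    unfolding is_unique_arg_min_def is_arg_min_def by (metis order.asym)
qed

text \<open>Forward: on the compact sphere of radius \<open>1 / real (Suc n)\<close> about
  \<open>x\<close> the continuous \<open>f\<close> exceeds \<open>f x\<close> by a positive margin,
  and convexity carries that margin to every point farther out. Backward: the points outside the
  closed ball that violate the margin form an open set, which would meet \<open>D\<close> if it were
  nonempty. On the right all quantifiers are countable once \<open>D\<close> is.\<close>

lemma unique_arg_min_convex_iff_dense: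
  fixes f :: "'a::euclidean_space \<Rightarrow> real"
  assumes cvx: "convex_on UNIV f"
    and dense: "\<And>X. open X \<Longrightarrow> X \<noteq> {} \<Longrightarrow> \<exists>d\<in>D. d \<in> X"
  shows "is_unique_arg_min f (\<lambda>_. True) x \<longleftrightarrow>
    (\<forall>n. \<exists>k. \<forall>q\<in>D. 1 / real (Suc n) < dist q x \<longrightarrow> f x + 1 / real (Suc k) \<le> f q)"
    (is "_ \<longleftrightarrow> ?R")
proof -
  have cont: "continuous_on UNIV f"
    using cvx by (simp add: convex_on_continuous)
  show ?thesis
  proof
    assume "is_unique_arg_min f (\<lambda>_. True) x"
    then have min: "f x < f y" if "y \<noteq> x" for y
      using that by (simp add: is_unique_arg_min_UNIV_iff)
    show ?R
    proof
      fix n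
      define r where "r = 1 / real (Suc n)"
      have r: "r > 0" by (simp add: r_def)
      have "\<exists>s\<in>sphere x r. \<forall>y\<in>sphere x r. f s \<le> f y"
        using r by (intro continuous_attains_inf continuous_on_subset[OF cont]) auto
      then obtain s where s: "s \<in> sphere x r" "\<And>y. y \<in> sphere x r \<Longrightarrow> f s \<le> f y" by blast
      then have "f s - f x > 0" using min[of s] r by auto
      then obtain k where k: "1 / real (Suc k) < f s - f x" using nat_approx_posE by blast
      have "f x + 1 / real (Suc k) \<le> f q" if q: "r < dist q x" for q
      proof -
        \<comment> \<open>With this ratio the point \<open>z\<close> of the segment from
          \<open>x\<close> to \<open>q\<close> lies on the sphere of radius
          \<open>r\<close>.\<close>
        define t where "t = r / dist q x"
        have t: "0 < t" "t < 1"
          using r q divide_pos_pos[of r "dist q x"] divide_less_eq_1_pos[of "dist q x" r]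
          unfolding t_def by linarith+
        define z where "z = (1 - t) *\<^sub>R x + t *\<^sub>R q"
        have "z - x = t *\<^sub>R (q - x)" by (simp add: z_def algebra_simps)
        then have "dist x z = t * dist q x"
          using t by (simp add: dist_norm norm_minus_commute[of x])
        also have "\<dots> = r" using r q by (auto simp: t_def)
        finally have "f s \<le> f z" using s by simp
        also have "f z \<le> (1 - t) * f x + t * f q"
          using convex_onD[OF cvx, of t x q] t by (simp add: z_def)
        finally have 1: "1 / real (Suc k) \<le> t * (f q - f x)" using k by (simp add: algebra_simps)
        moreover have "0 < 1 / real (Suc k)" by simp
        ultimately have "0 < t * (f q - f x)" by linarith
        \<comment> \<open>The sign of \<open>f q - f x\<close> is settled first, so that dropping
          the factor \<open>t\<close>, which is below 1, can only enlarge the bound.\<close>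
        then have "0 \<le> f q - f x" using t by (simp add: zero_less_mult_iff)
        then have "t * (f q - f x) \<le> f q - f x" using t by (simp add: mult_left_le_one_le)
        with 1 show ?thesis by linarith
      qed
      then show "\<exists>k. \<forall>q\<in>D. 1 / real (Suc n) < dist q x \<longrightarrow> f x + 1 / real (Suc k) \<le> f q"
        unfolding r_def by blast
    qed
  next
    assume R: ?R
    have "f x < f y" if "y \<noteq> x" for y
    proof -
      have "dist y x > 0" using that by simp
      then obtain n where n: "1 / real (Suc n) < dist y x" using nat_approx_posE by blast
      obtain k where k: "\<And>q. q \<in> D \<Longrightarrow> 1 / real (Suc n) < dist q x \<Longrightarrow> f x + 1 / real (Suc k) \<le> f q"
        using R by blast
      \<comment> \<open>\<open>X\<close> collects the points far from \<open>x\<close> that violate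
        the margin; the strict inequalities make it open.\<close>
      define X where "X = {z. f z < f x + 1 / real (Suc k)} \<inter> {z. 1 / real (Suc n) < dist z x}"
      have "open X" unfolding X_def
        by (intro open_Int open_Collect_less cont continuous_intros)
      moreover have "d \<notin> X" if "d \<in> D" for d
        using k[OF that] by (auto simp: X_def)
      ultimately have "X = {}" using dense by blast
      then have "y \<notin> X" by simp
      then have "f x + 1 / real (Suc k) \<le> f y" using n by (simp add: X_def not_less)
      moreover have "1 / real (Suc k) > 0" by simp
      ultimately show ?thesis by linarith
    qed
    then show "is_unique_arg_min f (\<lambda>_. True) x" by (simp add: is_unique_arg_min_UNIV_iff)
  qed
qed

text \<open>Measurability of \<open>F\<close> is given at fixed points only, yet \<open>F\<close> is
  evaluated at a random point. Approximating \<open>x\<close> by simple functions reduces this to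
  finitely many fixed points at a time, and continuity passes to the limit.\<close>

lemma borel_measurable_caratheodory:
  fixes F :: "'w \<Rightarrow> 'a::{metric_space, second_countable_topology} \<Rightarrow> real"
  assumes F: "\<And>y. (\<lambda>\<omega>. F \<omega> y) \<in> borel_measurable M"
    and cont: "\<And>\<omega>. \<omega> \<in> space M \<Longrightarrow> continuous_on UNIV (F \<omega>)"
    and x: "x \<in> borel_measurable M"
  shows "(\<lambda>\<omega>. F \<omega> (x \<omega>)) \<in> borel_measurable M"
proof -
  \<comment> \<open>\<open>undefined\<close> instantiates the reference point of a distance bound;
    any point would do.\<close>
  obtain s where s: "\<And>i. simple_function M (s i)"
    and lim: "\<And>\<omega>. \<omega> \<in> space M \<Longrightarrow> (\<lambda>i. s i \<omega>) \<longlonglongrightarrow> x \<omega>"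
    using borel_measurable_implies_sequence_metric[OF x, of undefined] by blast
  show ?thesis
  proof (rule borel_measurable_LIMSEQ_real)
    fix \<omega> assume "\<omega> \<in> space M"
    then show "(\<lambda>i. F \<omega> (s i \<omega>)) \<longlonglongrightarrow> F \<omega> (x \<omega>)"
      using continuous_on_tendsto_compose[OF cont lim] by simp
  next
    fix i
    \<comment> \<open>Over its finite range the simple function is a map into a discrete space, so
      the composition splits into finitely many fixed values.\<close>
    have "s i \<in> measurable M (count_space (s i ` space M))"
      using s[of i] by (auto simp: simple_function_def intro!: measurable_count_space_eq2[THEN iffD2])
    then show "(\<lambda>\<omega>. F \<omega> (s i \<omega>)) \<in> borel_measurable M"
      by (rule measurable_compose_countable'[where I = "s i ` space M", OF F])
        (use s[of i] in \<open>auto simp: simple_function_def intro: countable_finite\<close>)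
  qed
qed

text \<open>Convexity enters twice: through the countable criterion, and through continuity, which
  makes the value at the random point measurable.\<close>

lemma sets_unique_arg_min_convex:
  fixes F :: "'w \<Rightarrow> 'a::euclidean_space \<Rightarrow> real"
  assumes F: "\<And>y. (\<lambda>\<omega>. F \<omega> y) \<in> borel_measurable M"
    and cvx: "\<And>\<omega>. \<omega> \<in> space M \<Longrightarrow> convex_on UNIV (F \<omega>)"
    and x: "x \<in> borel_measurable M"
  shows "{\<omega> \<in> space M. is_unique_arg_min (F \<omega>) (\<lambda>_. True) (x \<omega>)} \<in> sets M"
proof -
  obtain D :: "'a set" where D: "countable D" "\<And>X. open X \<Longrightarrow> X \<noteq> {} \<Longrightarrow> \<exists>d\<in>D. d \<in> X"
    using countable_dense_setE by blast
  have Fx: "(\<lambda>\<omega>. F \<omega> (x \<omega>)) \<in> borel_measurable M"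
    by (rule borel_measurable_caratheodory[OF F convex_on_continuous[OF open_UNIV cvx] x])
  have "{\<omega> \<in> space M. 1 / real (Suc n) < dist q (x \<omega>) \<longrightarrow>
      F \<omega> (x \<omega>) + 1 / real (Suc k) \<le> F \<omega> q} \<in> sets M" for n k q
    by (intro sets.sets_Collect_imp borel_measurable_less borel_measurable_le borel_measurable_add
        borel_measurable_dist borel_measurable_const F Fx x)
  then have "{\<omega> \<in> space M. \<forall>n. \<exists>k. \<forall>q\<in>D. 1 / real (Suc n) < dist q (x \<omega>) \<longrightarrow>
      F \<omega> (x \<omega>) + 1 / real (Suc k) \<le> F \<omega> q} \<in> sets M"
    by (intro sets.sets_Collect_countable_All sets.sets_Collect_countable_Ex
        sets.sets_Collect_countable_All' D(1))
  moreover have "{\<omega> \<in> space M. is_unique_arg_min (F \<omega>) (\<lambda>_. True) (x \<omega>)} =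
      {\<omega> \<in> space M. \<forall>n. \<exists>k. \<forall>q\<in>D. 1 / real (Suc n) < dist q (x \<omega>) \<longrightarrow>
        F \<omega> (x \<omega>) + 1 / real (Suc k) \<le> F \<omega> q}"
    by (intro Collect_cong conj_cong refl unique_arg_min_convex_iff_dense cvx D(2))
  ultimately show ?thesis by simp
qed

section \<open>Penalty derivative and the weighted objective\<close>

text \<open>The absolute value matters: nothing is known about \<open>deriv P\<close> at negative arguments.\<close>

lemma borel_measurable_penalty_deriv_abs:
  assumes diff: "\<And>t. t > 0 \<Longrightarrow> P differentiable (at t)"
  shows "(\<lambda>t. penalty_deriv P \<bar>t\<bar>) \<in> borel_measurable borel"
proof -
  \<comment> \<open>Differentiability of \<open>P\<close> is known only at positive arguments; the
    cutoff to zero elsewhere yields a Borel function on the whole line.\<close>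
  define Q where "Q t = (if t \<in> {0<..} then P t else 0)" for t :: real
  have "continuous_on {0<..} P"
    using diff by (auto intro!: continuous_at_imp_continuous_on differentiable_imp_continuous_within)
  then have [measurable]: "Q \<in> borel_measurable borel"
    unfolding Q_def by (intro borel_measurable_continuous_on_if) auto
  \<comment> \<open>Forward difference quotients with step \<open>1 / real (Suc i)\<close> converge
    to the derivative away from zero. At zero the target is a limit of derivatives, so its value is
    inserted directly.\<close>
  define u where "u i t = (if t = 0 then penalty_deriv P 0
    else (Q (\<bar>t\<bar> + 1 / real (Suc i)) - Q \<bar>t\<bar>) / (1 / real (Suc i)))" for i and t :: real
  show ?thesis
  proof (rule borel_measurable_LIMSEQ_real)
    show "u i \<in> borel_measurable borel" for i
      unfolding u_def by measurable
    fix t :: real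
    show "(\<lambda>i. u i t) \<longlonglongrightarrow> penalty_deriv P \<bar>t\<bar>"
    proof (cases "t = 0")
      case False
      have "(P has_field_derivative deriv P \<bar>t\<bar>) (at \<bar>t\<bar>)"
        using diff[of "\<bar>t\<bar>"] False by (simp add: DERIV_deriv_iff_real_differentiable)
      then have "((\<lambda>h. (P (\<bar>t\<bar> + h) - P \<bar>t\<bar>) / h) \<longlongrightarrow> deriv P \<bar>t\<bar>) (at 0)"
        by (simp add: DERIV_def)
      moreover have "filterlim (\<lambda>i. 1 / real (Suc i)) (at 0) sequentially"
        using LIMSEQ_Suc[OF lim_1_over_n[where 'a = real]] by (simp add: filterlim_at)
      ultimately have "(\<lambda>i. (P (\<bar>t\<bar> + 1 / real (Suc i)) - P \<bar>t\<bar>) / (1 / real (Suc i)))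
          \<longlonglongrightarrow> deriv P \<bar>t\<bar>"
        by (rule filterlim_compose)
      moreover have "u i t = (P (\<bar>t\<bar> + 1 / real (Suc i)) - P \<bar>t\<bar>) / (1 / real (Suc i))" for i
      proof -
        have "\<bar>t\<bar> + 1 / real (Suc i) > 0" using False by (simp add: add_pos_pos)
        then show ?thesis using False by (simp add: u_def Q_def)
      qed
      ultimately show ?thesis using False by (simp add: penalty_deriv_def)
    qed (simp add: u_def)
  qed
qed

text \<open>Keeps every LLA objective convex, as the criterion for unique minimizers demands. At
  zero the bound \<open>a1 * lam\<close> gives the sign; at positive arguments monotonicity of
  \<open>P\<close> does.\<close>

lemma folded_concave_penalty_deriv_nonneg:
  assumes P: "folded_concave_penalty a1 a2 a lam P" and "lam > 0" and "t \<ge> 0"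
  shows "penalty_deriv P t \<ge> 0"
proof (cases "t = 0")
  case True
  have "0 \<le> a1 * lam" using P \<open>lam > 0\<close> by (simp add: folded_concave_penalty_def)
  also have "\<dots> \<le> penalty_deriv P 0" using P by (simp add: folded_concave_penalty_def)
  finally show ?thesis using True by simp
next
  case False
  then have "t > 0" using \<open>t \<ge> 0\<close> by simp
  have "mono_on {0..} P" and "(P has_field_derivative deriv P t) (at t)"
    using P \<open>t > 0\<close> by (auto simp: folded_concave_penalty_def DERIV_deriv_iff_real_differentiable)
  then have "deriv P t \<ge> 0"
    using \<open>t > 0\<close> mono_on_imp_deriv_nonneg[of "{0..}" P] by (simp add: interior_real_atLeast)
  then show ?thesis using False by (simp add: penalty_deriv_def)
qed

lemma convex_on_lla_objective:
  assumes "convex_on UNIV loss" and "\<And>j. penalty_deriv P \<bar>b $ j\<bar> \<ge> 0"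
  shows "convex_on UNIV (lla_objective loss P b)"
proof -
  have "convex_on UNIV (\<lambda>\<beta>::real^'a. \<bar>\<beta> $ j\<bar>)" for j
  proof (rule convex_onI)
    fix t :: real and x y :: "real^'a" assume t: "0 < t" "t < 1"
    have "\<bar>(1 - t) * x $ j + t * y $ j\<bar> \<le> \<bar>(1 - t) * x $ j\<bar> + \<bar>t * y $ j\<bar>"
      by (rule abs_triangle_ineq)
    then show "\<bar>((1 - t) *\<^sub>R x + t *\<^sub>R y) $ j\<bar> \<le> (1 - t) * \<bar>x $ j\<bar> + t * \<bar>y $ j\<bar>"
      using t by (simp add: abs_mult)
  qed simp
  then have summand: "convex_on UNIV (\<lambda>\<beta>. penalty_deriv P \<bar>b $ j\<bar> * \<bar>\<beta> $ j\<bar>)" for j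
    using assms(2) by (intro convex_on_cmul)
  have "convex_on UNIV (\<lambda>\<beta>. \<Sum>j\<in>S. penalty_deriv P \<bar>b $ j\<bar> * \<bar>\<beta> $ j\<bar>)" if "finite S" for S
    using that
  proof induction
    case empty
    show ?case by (simp add: convex_on_def)
  next
    case (insert j S)
    then show ?case using convex_on_add[OF summand] by simp
  qed
  then show ?thesis
    unfolding lla_objective_def by (intro convex_on_add assms(1)) simp
qed

section \<open>Optimality of the oracle estimator under suitable weights\<close>

text \<open>The vector \<open>b\<close> is arbitrary, so both iterations are covered. Competitors
  supported on \<open>A\<close> pay no penalty, like the oracle estimator, and lose by its
  uniqueness in the restricted problem. Any other competitor has a nonzero coordinate off
  \<open>A\<close>, where the weight strictly beats the subgradient.\<close>

lemma oracle_unique_arg_min_lla_objective: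
  fixes orac g :: "real ^ 'p::finite"
  assumes orac: "is_oracle_estimator loss A orac"
    and sub: "is_subgradient loss orac g"
    and g0: "\<And>j. j \<in> A \<Longrightarrow> g $ j = 0"
    and w0: "\<And>j. j \<in> A \<Longrightarrow> penalty_deriv P \<bar>b $ j\<bar> = 0"
    and gw: "\<And>j. j \<notin> A \<Longrightarrow> \<bar>g $ j\<bar> < penalty_deriv P \<bar>b $ j\<bar>"
  shows "is_unique_arg_min (lla_objective loss P b) (\<lambda>_. True) orac"
  unfolding is_unique_arg_min_UNIV_iff
proof (intro allI impI)
  fix \<beta> :: "real ^ 'p" assume ne: "\<beta> \<noteq> orac"
  let ?w = "\<lambda>j. penalty_deriv P \<bar>b $ j\<bar>"
  have o0: "orac $ j = 0" if "j \<notin> A" for j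
    using orac that unfolding is_oracle_estimator_def is_unique_arg_min_def is_arg_min_def by blast
  have "?w j * \<bar>orac $ j\<bar> = 0" for j using w0 o0 by (cases "j \<in> A") auto
  then have obj: "lla_objective loss P b orac = loss orac"
    unfolding lla_objective_def by (simp only: sum.neutral_const add_0_right)
  show "lla_objective loss P b orac < lla_objective loss P b \<beta>"
  proof (cases "\<forall>j\<in>-A. \<beta> $ j = 0")
    case True
    have "?w j * \<bar>\<beta> $ j\<bar> = 0" for j using w0 True by (cases "j \<in> A") auto
    then have "lla_objective loss P b \<beta> = loss \<beta>"
      unfolding lla_objective_def by (simp only: sum.neutral_const add_0_right)
    moreover have "loss orac < loss \<beta>"
    proof (rule ccontr)
      assume "\<not> loss orac < loss \<beta>"
      then have "is_arg_min loss (\<lambda>\<beta>. \<forall>j\<in>-A. \<beta> $ j = 0) \<beta>"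
        using orac True is_arg_min_antimono[of loss _ orac \<beta>]
        unfolding is_oracle_estimator_def is_unique_arg_min_def by (simp only: not_less)
      then show False
        using orac ne unfolding is_oracle_estimator_def is_unique_arg_min_def by blast
    qed
    ultimately show ?thesis using obj by simp
  next
    case False
    \<comment> \<open>Each summand pairs a coordinate of the subgradient bound with its penalty:
      zero on \<open>A\<close>, zero off \<open>A\<close> where \<open>\<beta>\<close> vanishes, and
      positive elsewhere.\<close>
    have nonneg: "0 \<le> g $ j * (\<beta> $ j - orac $ j) + ?w j * \<bar>\<beta> $ j\<bar>"
      and pos: "j \<notin> A \<Longrightarrow> \<beta> $ j \<noteq> 0 \<Longrightarrow> 0 < g $ j * (\<beta> $ j - orac $ j) + ?w j * \<bar>\<beta> $ j\<bar>" for j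
    proof -
      have *: "- (\<bar>g $ j\<bar> * \<bar>\<beta> $ j\<bar>) \<le> g $ j * \<beta> $ j"
        by (metis abs_ge_minus_self abs_mult minus_le_iff)
      show "0 < g $ j * (\<beta> $ j - orac $ j) + ?w j * \<bar>\<beta> $ j\<bar>" if "j \<notin> A" "\<beta> $ j \<noteq> 0"
      proof -
        have "\<bar>g $ j\<bar> * \<bar>\<beta> $ j\<bar> < ?w j * \<bar>\<beta> $ j\<bar>"
          using gw that by (intro mult_strict_right_mono) auto
        then show ?thesis using * o0[OF \<open>j \<notin> A\<close>] by simp
      qed
      then show "0 \<le> g $ j * (\<beta> $ j - orac $ j) + ?w j * \<bar>\<beta> $ j\<bar>"
        using g0 w0 o0 by (cases "j \<in> A"; cases "\<beta> $ j = 0") (auto intro: less_imp_le)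
    qed
    have "loss orac < loss orac + (\<Sum>j\<in>UNIV. g $ j * (\<beta> $ j - orac $ j) + ?w j * \<bar>\<beta> $ j\<bar>)"
      using False nonneg pos by (auto intro!: sum_pos2)
    also have "\<dots> = loss orac + g \<bullet> (\<beta> - orac) + (\<Sum>j\<in>UNIV. ?w j * \<bar>\<beta> $ j\<bar>)"
      by (simp add: sum.distrib inner_vec_def)
    also have "\<dots> \<le> lla_objective loss P b \<beta>"
      using sub by (simp add: lla_objective_def is_subgradient_def)
    finally show ?thesis using obj by simp
  qed
qed

text \<open>Once the oracle estimator reproduces itself, all later iterates coincide with it.\<close>

lemma lla_converges_after_two_iff:
  "lla_converges_after_two loss P init orac \<longleftrightarrow>
    is_unique_arg_min (lla_objective loss P init) (\<lambda>_. True) orac \<and>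
    is_unique_arg_min (lla_objective loss P orac) (\<lambda>_. True) orac" (is "?L \<longleftrightarrow> ?R")
proof
  assume ?L
  then obtain b where b: "lla_iterates loss P init b" "b 1 = orac" "b 2 = orac"
    unfolding lla_converges_after_two_def by blast
  then have "b 0 = init"
    and "is_unique_arg_min (lla_objective loss P (b m)) (\<lambda>_. True) (b (Suc m))" for m
    by (simp_all add: lla_iterates_def)
  from this(1) this(2)[of 0] this(2)[of 1] b(2,3) show ?R by (simp add: numeral_2_eq_2)
next
  assume ?R
  then have "lla_iterates loss P init (\<lambda>m. if m = 0 then init else orac)"
    by (simp add: lla_iterates_def)
  then show ?L unfolding lla_converges_after_two_def by force
qed

section \<open>Measurability of the events\<close>

lemma borel_measurable_vec_nth:
  fixes v :: "'w \<Rightarrow> real ^ 'n::finite"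
  shows "v \<in> borel_measurable M \<Longrightarrow> (\<lambda>\<omega>. v \<omega> $ j) \<in> borel_measurable M"
  by (rule measurable_compose[OF _ borel_measurable_nth])

text \<open>By \<open>lla_converges_after_two_iff\<close> the event is an intersection of two
  minimization events, with weights from \<open>init\<close> and from \<open>orac\<close>, so no
  quantifier over iterate sequences remains.\<close>

lemma sets_lla_converges_after_two:
  fixes loss :: "'w \<Rightarrow> real ^ 'p::finite \<Rightarrow> real"
  assumes loss: "\<And>\<beta>. (\<lambda>\<omega>. loss \<omega> \<beta>) \<in> borel_measurable M"
    and cvx: "\<And>\<omega>. \<omega> \<in> space M \<Longrightarrow> convex_on UNIV (loss \<omega>)"
    and P: "folded_concave_penalty a1 a2 a lam P" and "lam > 0"
    and init: "init \<in> borel_measurable M" and orac: "orac \<in> borel_measurable M"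
  shows "{\<omega> \<in> space M. lla_converges_after_two (loss \<omega>) P (init \<omega>) (orac \<omega>)} \<in> sets M"
proof -
  have weight: "(\<lambda>t. penalty_deriv P \<bar>t\<bar>) \<in> borel_measurable borel"
    using P by (intro borel_measurable_penalty_deriv_abs) (simp add: folded_concave_penalty_def)
  have "{\<omega> \<in> space M. is_unique_arg_min (lla_objective (loss \<omega>) P (b \<omega>)) (\<lambda>_. True) (orac \<omega>)} \<in> sets M"
    if b: "b \<in> borel_measurable M" for b
  proof (rule sets_unique_arg_min_convex)
    have "(\<lambda>\<omega>. penalty_deriv P \<bar>b \<omega> $ j\<bar>) \<in> borel_measurable M" for j
      by (rule measurable_compose[OF borel_measurable_vec_nth weight]) (rule b)
    then show "(\<lambda>\<omega>. lla_objective (loss \<omega>) P (b \<omega>) \<beta>) \<in> borel_measurable M" for \<beta>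
      unfolding lla_objective_def
      by (intro borel_measurable_add borel_measurable_sum borel_measurable_times
          borel_measurable_const loss)
    show "convex_on UNIV (lla_objective (loss \<omega>) P (b \<omega>))" if "\<omega> \<in> space M" for \<omega>
      using cvx[OF that] folded_concave_penalty_deriv_nonneg[OF P \<open>lam > 0\<close>]
      by (intro convex_on_lla_objective) auto
  qed (rule orac)
  from sets.Int[OF this[OF init] this[OF orac]] show ?thesis
    unfolding lla_converges_after_two_iff by (simp add: Int_def conj_ac cong: conj_cong)
qed

lemma borel_measurable_max_norm_on:
  assumes "v \<in> borel_measurable M"
  shows "(\<lambda>\<omega>. max_norm_on S (v \<omega>)) \<in> borel_measurable M"
  unfolding max_norm_on_def
  by (intro borel_measurable_SUP borel_measurable_ereal borel_measurable_abs
      borel_measurable_vec_nth assms countable_finite finite)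

lemma borel_measurable_min_norm_on:
  assumes "v \<in> borel_measurable M"
  shows "(\<lambda>\<omega>. min_norm_on S (v \<omega>)) \<in> borel_measurable M"
  unfolding min_norm_on_def
  by (intro borel_measurable_INF borel_measurable_ereal borel_measurable_abs
      borel_measurable_vec_nth assms countable_finite finite)

section \<open>From norm bounds to convergence\<close>

lemma max_norm_onD: "max_norm_on S v \<le> ereal c \<Longrightarrow> j \<in> S \<Longrightarrow> \<bar>v $ j\<bar> \<le> c"
  by (simp add: max_norm_on_def SUP_le_iff)

lemma max_norm_on_lessD: "max_norm_on S v < ereal c \<Longrightarrow> j \<in> S \<Longrightarrow> \<bar>v $ j\<bar> < c"
  unfolding max_norm_on_def by (metis SUP_lessD ereal_less_eq(3) less_ereal.simps(1))

lemma min_norm_on_lessD: "ereal c < min_norm_on S v \<Longrightarrow> j \<in> S \<Longrightarrow> c < \<bar>v $ j\<bar>"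
  unfolding min_norm_on_def by (metis less_INF_D less_ereal.simps(1))

text \<open>On \<open>A\<close> the gap between \<open>a + 1\<close> and \<open>a\<close> absorbs an
  initial error of at most \<open>lam\<close> and leaves the initial coordinates in the flat range
  of the penalty. Off \<open>A\<close> the true coordinate is zero, so the initial one is at most
  \<open>a2 * lam\<close> in absolute value, where the derivative is at least
  \<open>a1 * lam\<close>.\<close>

lemma lla_converges_after_two_if_close:
  fixes beta_star init orac g :: "real ^ 'p::finite"
  assumes orac: "is_oracle_estimator loss A orac"
    and sub: "is_subgradient loss orac g"
    and g0: "\<And>j. j \<in> A \<Longrightarrow> g $ j = 0"
    and A: "A = {j. beta_star $ j \<noteq> 0}"
    and "lam > 0"
    and P: "folded_concave_penalty a1 a2 a lam P"
    and star: "min_norm_on A beta_star > ereal ((a + 1) * lam)"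
    and init: "max_norm_on UNIV (init - beta_star) \<le> ereal (min 1 a2 * lam)"
    and g: "max_norm_on (- A) g < ereal (a1 * lam)"
    and orac_large: "min_norm_on A orac > ereal (a * lam)"
  shows "lla_converges_after_two loss P init orac"
proof -
  have small: "a1 * lam \<le> penalty_deriv P t" if "0 \<le> t" "t \<le> a2 * lam" for t
    using P that by (cases "t = 0") (auto simp: folded_concave_penalty_def)
  have large: "penalty_deriv P t = 0" if "a * lam \<le> t" for t
    using P that by (simp add: folded_concave_penalty_def)
  \<comment> \<open>The two arguments of \<open>min\<close> serve different coordinates: 1 those in
    \<open>A\<close>, \<open>a2\<close> those outside.\<close>
  have close: "\<bar>init $ j - beta_star $ j\<bar> \<le> lam" "\<bar>init $ j - beta_star $ j\<bar> \<le> a2 * lam" for j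
  proof -
    have "\<bar>init $ j - beta_star $ j\<bar> \<le> min 1 a2 * lam"
      using max_norm_onD[OF init, of j] by simp
    moreover have "min 1 a2 * lam \<le> 1 * lam" "min 1 a2 * lam \<le> a2 * lam"
      using \<open>lam > 0\<close> by (intro mult_right_mono; simp)+
    ultimately show "\<bar>init $ j - beta_star $ j\<bar> \<le> lam" "\<bar>init $ j - beta_star $ j\<bar> \<le> a2 * lam"
      by linarith+
  qed
  have g_small: "\<bar>g $ j\<bar> < a1 * lam" if "j \<notin> A" for j
    using max_norm_on_lessD[OF g] that by simp
  have "is_unique_arg_min (lla_objective loss P init) (\<lambda>_. True) orac"
  proof (rule oracle_unique_arg_min_lla_objective[OF orac sub g0])
    fix j assume "j \<in> A"
    then have "a * lam + lam < \<bar>beta_star $ j\<bar>"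
      using min_norm_on_lessD[OF star] by (simp add: algebra_simps)
    then show "penalty_deriv P \<bar>init $ j\<bar> = 0"
      using close(1)[of j] by (intro large) linarith
  next
    fix j assume "j \<notin> A"
    then show "\<bar>g $ j\<bar> < penalty_deriv P \<bar>init $ j\<bar>"
      using g_small[of j] close(2)[of j] small[of "\<bar>init $ j\<bar>"] by (simp add: A)
  qed
  moreover have "is_unique_arg_min (lla_objective loss P orac) (\<lambda>_. True) orac"
  proof (rule oracle_unique_arg_min_lla_objective[OF orac sub g0])
    fix j assume "j \<in> A"
    then show "penalty_deriv P \<bar>orac $ j\<bar> = 0"
      using min_norm_on_lessD[OF orac_large] by (intro large) force
  next
    fix j assume "j \<notin> A"
    \<comment> \<open>In the second iteration the weight off \<open>A\<close> is the right
      derivative at zero, because the oracle coordinate is exactly zero.\<close>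
    moreover from this have "orac $ j = 0"
      using orac unfolding is_oracle_estimator_def is_unique_arg_min_def is_arg_min_def by blast
    moreover have "0 \<le> a2 * lam" using P \<open>lam > 0\<close> by (simp add: folded_concave_penalty_def)
    ultimately show "\<bar>g $ j\<bar> < penalty_deriv P \<bar>orac $ j\<bar>"
      using g_small[of j] small[of 0] by simp
  qed
  ultimately show ?thesis by (simp add: lla_converges_after_two_iff)
qed

theorem corollary2:
  fixes M :: "'w measure"
    and loss :: "'w \<Rightarrow> real ^ 'p::finite \<Rightarrow> real"
    and beta_star :: "real ^ 'p"
    and A :: "'p set"
    and lam a1 a2 a a0 :: real
    and P :: "real \<Rightarrow> real"
    and beta_init beta_oracle grad :: "'w \<Rightarrow> real ^ 'p"
  assumes "prob_space M"
    and "\<And>\<beta>. (\<lambda>\<omega>. loss \<omega> \<beta>) \<in> borel_measurable M"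
    and "\<And>\<omega>. \<omega> \<in> space M \<Longrightarrow> convex_on UNIV (loss \<omega>)"
    and "A = {j. beta_star $ j \<noteq> 0}"
    and "lam > 0"
    and "folded_concave_penalty a1 a2 a lam P"
    and "a0 = min 1 a2"
    and "min_norm_on A beta_star > ereal ((a + 1) * lam)"
    and "beta_init \<in> borel_measurable M"
    and "beta_oracle \<in> borel_measurable M"
    and "\<And>\<omega>. \<omega> \<in> space M \<Longrightarrow> is_oracle_estimator (loss \<omega>) A (beta_oracle \<omega>)"
    and "grad \<in> borel_measurable M"
    and "\<And>\<omega>. \<omega> \<in> space M \<Longrightarrow> is_subgradient (loss \<omega>) (beta_oracle \<omega>) (grad \<omega>)"
    and "\<And>\<omega> j. \<omega> \<in> space M \<Longrightarrow> j \<in> A \<Longrightarrow> grad \<omega> $ j = 0"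
  shows "\<P>(\<omega> in M. lla_converges_after_two (loss \<omega>) P (beta_init \<omega>) (beta_oracle \<omega>))
    \<ge> 1 - \<P>(\<omega> in M. max_norm_on UNIV (beta_init \<omega> - beta_star) > ereal (a0 * lam))
        - \<P>(\<omega> in M. max_norm_on (- A) (grad \<omega>) \<ge> ereal (a1 * lam))
        - \<P>(\<omega> in M. min_norm_on A (beta_oracle \<omega>) \<le> ereal (a * lam))"
proof -
  define C where "C = {\<omega> \<in> space M.
    lla_converges_after_two (loss \<omega>) P (beta_init \<omega>) (beta_oracle \<omega>)}"
  define B0 where "B0 = {\<omega> \<in> space M. max_norm_on UNIV (beta_init \<omega> - beta_star) > ereal (a0 * lam)}"
  define B1 where "B1 = {\<omega> \<in> space M. max_norm_on (- A) (grad \<omega>) \<ge> ereal (a1 * lam)}"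
  define B2 where "B2 = {\<omega> \<in> space M. min_norm_on A (beta_oracle \<omega>) \<le> ereal (a * lam)}"
  have sets: "B0 \<in> sets M" "B1 \<in> sets M" "B2 \<in> sets M"
    unfolding B0_def B1_def B2_def
    by (intro borel_measurable_less borel_measurable_le borel_measurable_const
        borel_measurable_max_norm_on borel_measurable_min_norm_on borel_measurable_diff
        assms(9,10,12))+
  have C: "C \<in> sets M"
    unfolding C_def using assms by (intro sets_lla_converges_after_two) auto
  \<comment> \<open>Contrapositive of the fixed-sample lemma: failure of convergence forces one of
    the three exceptional events.\<close>
  have "space M - C \<subseteq> B0 \<union> B1 \<union> B2"
  proof
    fix \<omega> assume \<omega>: "\<omega> \<in> space M - C"
    show "\<omega> \<in> B0 \<union> B1 \<union> B2"
    proof (rule ccontr)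
      assume "\<omega> \<notin> B0 \<union> B1 \<union> B2"
      with \<omega> have "lla_converges_after_two (loss \<omega>) P (beta_init \<omega>) (beta_oracle \<omega>)"
        unfolding B0_def B1_def B2_def
        by (intro lla_converges_after_two_if_close[OF assms(11,13,14,4,5,6,8)])
          (auto simp: not_less not_le assms(7))
      with \<omega> show False by (simp add: C_def)
    qed
  qed
  then have "1 - measure M C \<le> measure M (B0 \<union> B1 \<union> B2)"
    unfolding prob_space.prob_compl[OF assms(1) C, symmetric]
    by (intro finite_measure.finite_measure_mono prob_space.finite_measure assms(1) sets.Un sets)
  also have "\<dots> \<le> measure M (B0 \<union> B1) + measure M B2"
    using sets by (intro measure_Un_le) auto
  also have "\<dots> \<le> measure M B0 + measure M B1 + measure M B2"
    using sets by (intro add_right_mono measure_Un_le)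
  finally show ?thesis
    unfolding C_def B0_def B1_def B2_def by linarith
qed

end
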